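(* Let $E$ be a unital Banach algebra, let $a<b$, let $\Lambda\subset[a,b]$ be a well-ordered set (in the order of $\mathbb R$) with $\min\Lambda=a$ and $\max\Lambda=b$, let $(z_\alpha)_{\alpha\in\Lambda}$ be a family in $E$, and let $A:[a,b]\to E$ be given by $A(t)=z_\alpha$ for $t\in[\alpha,S(\alpha))$, $\alpha\in\Lambda$, $\alpha<b$, and $A(b)=z_b$. Then the following conditions are equivalent: 1. $A$ is Riemann product integrable. 2. The family $(z_\alpha)_{\alpha\in\Lambda}$ is bounded.
   Context: A unital Banach algebra is a complete normed algebra with unit $I$, $\|I\|=1$. For $\alpha\in\Lambda$, $\alpha<b$, $S(\alpha)$ is the smallest element of $\Lambda$ greater than $\alpha$. $A:[a,b]\to E$ is Riemann product integrable if there is an invertible $P\in E$ such that for every $\varepsilon>0$ there is a constant $\delta>0$ with $$\|(I+A(\xi_m)(t_m-t_{m-1}))(I+A(\xi_{m-1})(t_{m-1}-t_{m-2}))\cdots(I+A(\xi_1)(t_1-t_0))-P\|<\varepsilon$$ for all $a=t_0<t_1<\dots<t_m=b$ and $\xi_i\in[t_{i-1},t_i]$ with $[t_{i-1},t_i]\subset(\xi_i-\delta,\xi_i+\delta)$ for all $i$.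
   Formalization: The formal theorem also assumes that the intervals [α,S(α)), α∈Λ, α<b, cover [a,b); without this A is not defined on all of [a,b], e.g. for Λ={1-1/n : n≥1}∪{2} the values on [1,2) are undetermined. *)

theory Defs
  imports "HOL-Analysis.Analysis"
begin

text \<open>
  Unital Banach algebras are rendered as types of class
  \<open>{real_normed_algebra_1, banach}\<close>, in which \<open>norm 1 = 1\<close>. Only real scalars are needed.
\<close>

text \<open>A two-sided inverse is required, since \<open>E\<close> need not be commutative.\<close>

definition invertible_in_algebra :: "'a::real_normed_algebra_1 \<Rightarrow> bool"
  where "invertible_in_algebra P \<longleftrightarrow> (\<exists>Q. P * Q = 1 \<and> Q * P = 1)"

text \<open>
  The subintervals are \<open>[t i, t (Suc i)]\<close> with tag \<open>\<xi> i\<close> for \<open>i < m\<close>, so the tag written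
  \<open>\<xi>\<^sub>i\<close> in one-based notation is \<open>\<xi> (i - 1)\<close> here.
\<close>

definition fine_tagged_partition ::
    "real \<Rightarrow> real \<Rightarrow> real \<Rightarrow> nat \<Rightarrow> (nat \<Rightarrow> real) \<Rightarrow> (nat \<Rightarrow> real) \<Rightarrow> bool"
  where "fine_tagged_partition \<delta> a b m t \<xi> \<longleftrightarrow>
    t 0 = a \<and> t m = b \<and>
    (\<forall>i<m. t i < t (Suc i) \<and>
           \<xi> i \<in> {t i..t (Suc i)} \<and>
           {t i..t (Suc i)} \<subseteq> {\<xi> i - \<delta><..<\<xi> i + \<delta>})"

text \<open>The list is reversed because factors belonging to later subintervals stand on the left.\<close>

definition Riemann_product ::
    "(real \<Rightarrow> 'a::real_normed_algebra_1) \<Rightarrow> nat \<Rightarrow> (nat \<Rightarrow> real) \<Rightarrow> (nat \<Rightarrow> real) \<Rightarrow> 'a"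
  where "Riemann_product A m t \<xi> =
    prod_list (map (\<lambda>i. 1 + (t (Suc i) - t i) *\<^sub>R A (\<xi> i)) (rev [0..<m]))"

definition Riemann_product_integrable ::
    "(real \<Rightarrow> 'a::real_normed_algebra_1) \<Rightarrow> real \<Rightarrow> real \<Rightarrow> bool"
  where "Riemann_product_integrable A a b \<longleftrightarrow>
    (\<exists>P. invertible_in_algebra P \<and>
      (\<forall>\<epsilon>>0. \<exists>\<delta>>0. \<forall>m t \<xi>. fine_tagged_partition \<delta> a b m t \<xi> \<longrightarrow>
        norm (Riemann_product A m t \<xi> - P) < \<epsilon>))"

text \<open>
  \<open>succ_in \<Lambda> \<alpha>\<close> is \<open>S(\<alpha>)\<close>; it is meaningful when \<open>\<Lambda>\<close> is well-ordered and has an element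
  above \<open>\<alpha>\<close>. For a well-ordered \<open>\<Lambda> \<subseteq> [a,b]\<close> containing \<open>a\<close> and \<open>b\<close>, the intervals
  \<open>[\<alpha>, S(\<alpha>))\<close> need not exhaust \<open>[a,b)\<close>: for \<open>\<Lambda> = {1 - 1/n | n \<ge> 1} \<union> {2}\<close> they miss
  \<open>[1,2)\<close>. A function on \<open>[a,b]\<close> can be defined by its values on these intervals only if
  they cover \<open>[a,b)\<close>.
\<close>

definition succ_in :: "real set \<Rightarrow> real \<Rightarrow> real"
  where "succ_in \<Lambda> \<alpha> = (LEAST \<beta>. \<beta> \<in> \<Lambda> \<and> \<alpha> < \<beta>)"

end

theory Submission
  imports Defs
begin

text \<open>
  Integrable implies bounded, for arbitrary \<open>A\<close>: boundedness spreads along \<open>[a, b]\<close>. Suppose \<open>A\<close>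
  is bounded on \<open>[a, x]\<close> and \<open>x \<le> c \<le> y\<close> with \<open>y - x\<close> small. Fix fine products \<open>R\<close> over
  \<open>[a, x]\<close> and \<open>L\<close> over \<open>[y, b]\<close>; then \<open>L (1 + (y - x) A(\<xi>)) R\<close> is close to \<open>P\<close> for
  every \<open>\<xi> \<in> [x, y]\<close>. Boundedness makes \<open>R\<close> invertible, and the factor with tag \<open>\<xi> = c\<close> is
  invertible because \<open>y - x\<close> may be chosen depending on \<open>A(c)\<close>. Hence \<open>L\<close> is invertible, and
  cancelling \<open>L\<close> and \<open>R\<close> bounds \<open>A(\<xi>)\<close> on \<open>[x, y]\<close>.

  Bounded implies integrable: for bounded \<open>A\<close>, splitting a fine product at a point \<open>c\<close> changes it
  little, so the Cauchy criterion for Riemann products passes from \<open>[x, c]\<close> and \<open>[c, y]\<close> to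
  \<open>[x, y]\<close>, and from all \<open>[x, c]\<close> with \<open>c < y\<close> to \<open>[x, y]\<close>. Where \<open>A\<close> is constant the
  products converge to an exponential. Induction along \<open>\<Lambda>\<close> then gives the criterion on \<open>[a, b]\<close>, and
  the limit is invertible since fine products have uniformly bounded inverses.
\<close>

section \<open>Neumann series and stability of invertibility\<close>

lemma one_minus_inverse_bound:
  fixes x :: "'a::{real_normed_algebra_1, banach}"
  assumes "norm x < 1"
  shows "\<exists>y. (1 - x) * y = 1 \<and> y * (1 - x) = 1 \<and> norm y \<le> 1 / (1 - norm x)"
proof -
  have geo: "(\<lambda>n. norm x ^ n) sums (1 / (1 - norm x))"
    using geometric_sums[of "norm x"] assms by simp
  have sn: "summable (\<lambda>n. norm (x ^ n))"
    by (rule summable_comparison_test'[OF sums_summable[OF geo], of 0]) (simp add: norm_power_ineq)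
  \<comment> \<open>The Neumann series: dominated in norm by the geometric series, while
    multiplication by \<open>1 - x\<close> on either side makes it telescope to
    \<open>1\<close>.\<close>
  define y where "y = (\<Sum>n. x ^ n)"
  have sm: "summable (\<lambda>n. x ^ n)"
    using sn by (rule summable_norm_cancel)
  have "norm y \<le> (\<Sum>n. norm (x ^ n))"
    unfolding y_def using sn by (rule summable_norm)
  also have "\<dots> \<le> (\<Sum>n. norm x ^ n)"
    by (rule suminf_le[OF _ sn sums_summable[OF geo]]) (simp add: norm_power_ineq)
  finally have bound: "norm y \<le> 1 / (1 - norm x)"
    using sums_unique[OF geo] by simp
  have tele: "(\<lambda>n. x ^ n - x ^ Suc n) sums 1"
    using telescope_sums'[OF summable_LIMSEQ_zero[OF sm]] by simp
  have s: "(\<lambda>n. x ^ n) sums y"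
    unfolding y_def using sm by (rule summable_sums)
  have "(\<lambda>n. (1 - x) * x ^ n) sums ((1 - x) * y)" "(\<lambda>n. x ^ n * (1 - x)) sums (y * (1 - x))"
    using s by (rule sums_mult sums_mult2)+
  moreover have "(1 - x) * x ^ n = x ^ n - x ^ Suc n" "x ^ n * (1 - x) = x ^ n - x ^ Suc n" for n
    by (simp_all add: algebra_simps power_commutes)
  ultimately show ?thesis
    using bound tele by (auto dest: sums_unique2)
qed

text \<open>The restriction to norm at most 1/2 gives \<open>1 / (1 - s) \<le> 1 + 2 * s\<close>.
  The exponential form is chosen so that bounds for successive factors multiply to a bound in the
  total length.\<close>

lemma one_plus_inverse_exp_bound:
  fixes x :: "'a::{real_normed_algebra_1, banach}"
  assumes "norm x \<le> 1 / 2"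
  shows "\<exists>y. (1 + x) * y = 1 \<and> y * (1 + x) = 1 \<and> norm y \<le> exp (2 * norm x)"
proof -
  obtain y where y: "(1 - - x) * y = 1" "y * (1 - - x) = 1" "norm y \<le> 1 / (1 - norm (- x))"
    using one_minus_inverse_bound[of "- x"] assms by auto
  have "0 \<le> norm x * (1 - 2 * norm x)"
    using assms by simp
  then have "1 / (1 - norm x) \<le> 1 + 2 * norm x"
    using assms by (simp add: field_simps)
  also have "\<dots> \<le> exp (2 * norm x)"
    by (rule exp_ge_add_one_self)
  finally show ?thesis
    using y by (intro exI[of _ y]) auto
qed

lemma invertible_in_algebra_mult:
  assumes "invertible_in_algebra x" "invertible_in_algebra y"
  shows "invertible_in_algebra (x * y)"
proof -
  obtain u v where "x * u = 1" "u * x = 1" "y * v = 1" "v * y = 1"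
    using assms by (auto simp: invertible_in_algebra_def)
  then have "(x * y) * (v * u) = 1" "(v * u) * (x * y) = 1"
    by (metis mult.assoc mult.left_neutral)+
  then show ?thesis
    unfolding invertible_in_algebra_def by blast
qed

lemma invertible_in_algebra_cancel_right:
  assumes "invertible_in_algebra (x * y)" "invertible_in_algebra y"
  shows "invertible_in_algebra x"
proof -
  obtain v where v: "y * v = 1" "v * y = 1"
    using assms(2) by (auto simp: invertible_in_algebra_def)
  then have "invertible_in_algebra v"
    unfolding invertible_in_algebra_def by blast
  with assms(1) have "invertible_in_algebra (x * y * v)"
    by (rule invertible_in_algebra_mult)
  with v show ?thesis
    by (simp add: mult.assoc)
qed

text \<open>Writes \<open>P = X * (1 - Y * (X - P))\<close> with \<open>Y\<close> the inverse of
  \<open>X\<close>; the second factor has a Neumann inverse. The separate constant \<open>K\<close>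
  allows one bound to serve a whole sequence of \<open>X\<close>.\<close>

lemma invertible_in_algebra_near:
  fixes X P :: "'a::{real_normed_algebra_1, banach}"
  assumes "X * Y = 1" "Y * X = 1" "norm Y \<le> K" "K * norm (X - P) < 1"
  shows "invertible_in_algebra P"
proof -
  have "norm (Y * (X - P)) \<le> norm Y * norm (X - P)"
    by (rule norm_mult_ineq)
  also have "\<dots> \<le> K * norm (X - P)"
    using assms(3) by (rule mult_right_mono) simp
  also note assms(4)
  finally obtain U where "(1 - Y * (X - P)) * U = 1" "U * (1 - Y * (X - P)) = 1"
    using one_minus_inverse_bound by blast
  then have "invertible_in_algebra (1 - Y * (X - P))"
    unfolding invertible_in_algebra_def by blast
  moreover have "invertible_in_algebra X"
    unfolding invertible_in_algebra_def using assms by blast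
  moreover have "X * (1 - Y * (X - P)) = P"
    using assms(1,2) by (simp add: right_diff_distrib mult.assoc[symmetric])
  ultimately show ?thesis
    using invertible_in_algebra_mult by metis
qed

section \<open>Fine products as a relation, without explicit partitions\<close>

text \<open>
  \<open>Riemann_value A \<delta> x y X\<close> says that \<open>X\<close> is the product over some \<open>\<delta>\<close>-fine tagged partition of
  \<open>[x, y]\<close>; forgetting the partition itself makes concatenation and splitting painless.
\<close>

inductive Riemann_value ::
    "(real \<Rightarrow> 'a::real_normed_algebra_1) \<Rightarrow> real \<Rightarrow> real \<Rightarrow> real \<Rightarrow> 'a \<Rightarrow> bool"
  for A \<delta> x where
  refl: "Riemann_value A \<delta> x x 1"
| step: "Riemann_value A \<delta> x y X \<Longrightarrow> y < w \<Longrightarrow> y \<le> \<xi> \<Longrightarrow> \<xi> \<le> w \<Longrightarrow> \<xi> - \<delta> < y \<Longrightarrow> w < \<xi> + \<delta>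
    \<Longrightarrow> Riemann_value A \<delta> x w ((1 + (w - y) *\<^sub>R A \<xi>) * X)"

lemma Riemann_product_Suc:
  "Riemann_product A (Suc m) t \<xi> = (1 + (t (Suc m) - t m) *\<^sub>R A (\<xi> m)) * Riemann_product A m t \<xi>"
  by (simp add: Riemann_product_def)

lemma Riemann_product_cong:
  assumes "\<And>i. i \<le> m \<Longrightarrow> t i = t' i" "\<And>i. i < m \<Longrightarrow> \<xi> i = \<xi>' i"
  shows "Riemann_product A m t \<xi> = Riemann_product A m t' \<xi>'"
  unfolding Riemann_product_def using assms
  by (intro arg_cong[of _ _ prod_list] map_cong) auto

lemma Riemann_value_if_partition:
  "fine_tagged_partition \<delta> a b m t \<xi> \<Longrightarrow> Riemann_value A \<delta> a b (Riemann_product A m t \<xi>)"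
proof (induction m arbitrary: b)
  case 0
  then show ?case
    by (auto simp: fine_tagged_partition_def Riemann_product_def intro: Riemann_value.refl)
next
  case (Suc m)
  have "fine_tagged_partition \<delta> a (t m) m t \<xi>"
    using Suc.prems by (simp add: fine_tagged_partition_def)
  then have *: "Riemann_value A \<delta> a (t m) (Riemann_product A m t \<xi>)"
    by (rule Suc.IH)
  have m: "t m < t (Suc m)" "\<xi> m \<in> {t m..t (Suc m)}"
      "{t m..t (Suc m)} \<subseteq> {\<xi> m - \<delta><..<\<xi> m + \<delta>}" and b: "b = t (Suc m)"
    using Suc.prems by (auto simp: fine_tagged_partition_def)
  then have "\<xi> m - \<delta> < t m" "t (Suc m) < \<xi> m + \<delta>"
    by (auto dest: subsetD[of _ _ "t m"] subsetD[of _ _ "t (Suc m)"])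
  then show ?case
    unfolding Riemann_product_Suc b using m by (intro Riemann_value.step[OF *]) auto
qed

lemma partition_if_Riemann_value:
  "Riemann_value A \<delta> a b X \<Longrightarrow> \<exists>m t \<xi>. fine_tagged_partition \<delta> a b m t \<xi> \<and> X = Riemann_product A m t \<xi>"
proof (induction rule: Riemann_value.induct)
  case refl
  show ?case
    by (rule exI[of _ 0]) (auto simp: fine_tagged_partition_def Riemann_product_def)
next
  case (step y X w \<xi>)
  then obtain m t s where *: "fine_tagged_partition \<delta> a y m t s" "X = Riemann_product A m t s"
    by blast
  \<comment> \<open>The extra interval has index \<open>m\<close>: its tag sits at \<open>m\<close>,
    its right endpoint at \<open>Suc m\<close>.\<close>
  define t' s' where "t' = t(Suc m := w)" and "s' = s(m := \<xi>)"
  have "fine_tagged_partition \<delta> a w (Suc m) t' s'"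
    using * step by (auto simp: fine_tagged_partition_def t'_def s'_def less_Suc_eq)
  moreover have "Riemann_product A m t' s' = X"
    unfolding *(2) by (rule Riemann_product_cong) (auto simp: t'_def s'_def)
  then have "(1 + (w - y) *\<^sub>R A \<xi>) * X = Riemann_product A (Suc m) t' s'"
    unfolding Riemann_product_Suc using *(1) by (simp add: t'_def s'_def fine_tagged_partition_def)
  ultimately show ?case
    by blast
qed

text \<open>The bridge to the definition of integrability; all later estimates are about
  \<open>Riemann_value\<close>.\<close>

lemma Riemann_product_integrable_iff:
  fixes A :: "real \<Rightarrow> 'a::real_normed_algebra_1"
  shows "Riemann_product_integrable A a b \<longleftrightarrow> (\<exists>P. invertible_in_algebra P \<and>
    (\<forall>\<epsilon>>0. \<exists>\<delta>>0. \<forall>X. Riemann_value A \<delta> a b X \<longrightarrow> norm (X - P) < \<epsilon>))"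
proof -
  have "(\<forall>m t \<xi>. fine_tagged_partition \<delta> a b m t \<xi> \<longrightarrow> Q (Riemann_product A m t \<xi>)) \<longleftrightarrow>
      (\<forall>X. Riemann_value A \<delta> a b X \<longrightarrow> Q X)" for \<delta> and Q :: "'a \<Rightarrow> bool"
    using Riemann_value_if_partition partition_if_Riemann_value by metis
  from this[of _ "\<lambda>X. norm (X - _) < _"] show ?thesis
    unfolding Riemann_product_integrable_def by simp
qed

lemma Riemann_value_le: "Riemann_value A \<delta> x y X \<Longrightarrow> x \<le> y"
  by (induction rule: Riemann_value.induct) auto

lemma Riemann_value_self: "Riemann_value A \<delta> x x X \<Longrightarrow> X = 1"
  by (erule Riemann_value.cases) (auto dest: Riemann_value_le)

lemma Riemann_value_mono:
  "Riemann_value A \<delta> x y X \<Longrightarrow> \<delta> \<le> \<delta>' \<Longrightarrow> Riemann_value A \<delta>' x y X"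
proof (induction rule: Riemann_value.induct)
  case (step y X w \<xi>)
  then show ?case by (intro Riemann_value.step) auto
qed (rule Riemann_value.refl)

lemma Riemann_value_single:
  assumes "y < w" "y \<le> \<xi>" "\<xi> \<le> w" "\<xi> - \<delta> < y" "w < \<xi> + \<delta>"
  shows "Riemann_value A \<delta> y w (1 + (w - y) *\<^sub>R A \<xi>)"
  using Riemann_value.step[OF Riemann_value.refl assms, of A] by simp

lemma Riemann_value_append:
  "Riemann_value A \<delta> y w Y \<Longrightarrow> Riemann_value A \<delta> x y X \<Longrightarrow> Riemann_value A \<delta> x w (Y * X)"
proof (induction rule: Riemann_value.induct)
  case (step v Y w \<xi>)
  then show ?case
    unfolding mult.assoc by (intro Riemann_value.step) auto
qed simp

lemma Riemann_value_exists:
  assumes "0 < \<delta>" "x \<le> y"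
  shows "\<exists>X. Riemann_value A \<delta> x y X"
proof (cases "x = y")
  case True
  then show ?thesis using Riemann_value.refl by blast
next
  case False
  then have "x < y" using assms by simp
  obtain n :: nat where n: "(y - x) / \<delta> < real n"
    using reals_Archimedean2 by blast
  then have "0 < real n"
    using \<open>x < y\<close> assms by (smt (verit) divide_pos_pos)
  \<comment> \<open>Equal pieces of length \<open>h < \<delta>\<close>, each tagged at its left
    endpoint, are fine.\<close>
  define h where "h = (y - x) / real n"
  have h: "0 < h" "h < \<delta>" "x + real n * h = y"
    using n \<open>0 < real n\<close> \<open>x < y\<close> assms by (auto simp: h_def field_simps)
  have "\<exists>X. Riemann_value A \<delta> x (x + real k * h) X" for k
  proof (induction k)
    case 0
    show ?case using Riemann_value.refl[of A \<delta> x] by auto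
  next
    case (Suc k)
    then obtain X where "Riemann_value A \<delta> x (x + real k * h) X" by blast
    from Riemann_value.step[OF this, of "x + real (Suc k) * h" "x + real k * h"] h
    show ?case by (auto simp: algebra_simps)
  qed
  from this[of n] h show ?thesis by simp
qed

section \<open>Exponential bounds for products of a bounded function\<close>

lemma norm_one_plus_scaleR_le:
  fixes u :: "'a::real_normed_algebra_1"
  assumes "norm u \<le> M" "0 \<le> h"
  shows "norm (1 + h *\<^sub>R u) \<le> exp (M * h)"
proof -
  have "norm (1 + h *\<^sub>R u) \<le> 1 + norm (h *\<^sub>R u)"
    using norm_triangle_ineq[of 1 "h *\<^sub>R u"] by simp
  also have "\<dots> \<le> 1 + M * h"
    using assms by (simp add: mult.commute[of M] mult_left_mono)
  also have "\<dots> \<le> exp (M * h)"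
    by (rule exp_ge_add_one_self)
  finally show ?thesis .
qed

lemma Riemann_value_norm_le:
  "Riemann_value A \<delta> x y X \<Longrightarrow> (\<And>t. t \<in> {x..y} \<Longrightarrow> norm (A t) \<le> M) \<Longrightarrow> norm X \<le> exp (M * (y - x))"
proof (induction rule: Riemann_value.induct)
  case (step y X w \<xi>)
  have "x \<le> y" using step.hyps(1) by (rule Riemann_value_le)
  have IH: "norm X \<le> exp (M * (y - x))" using step by auto
  have "norm ((1 + (w - y) *\<^sub>R A \<xi>) * X) \<le> norm (1 + (w - y) *\<^sub>R A \<xi>) * norm X"
    by (rule norm_mult_ineq)
  also have "\<dots> \<le> exp (M * (w - y)) * exp (M * (y - x))"
    using step \<open>x \<le> y\<close> by (intro mult_mono IH norm_one_plus_scaleR_le) auto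
  also have "\<dots> = exp (M * (w - x))"
    by (simp add: exp_add[symmetric] algebra_simps)
  finally show ?case .
qed simp

text \<open>The bound is uniform in \<delta>: over a short interval every product is near
  \<open>1\<close>. This controls the last stretch before a limit point.\<close>

lemma Riemann_value_diff_one_le:
  "Riemann_value A \<delta> x y X \<Longrightarrow> (\<And>t. t \<in> {x..y} \<Longrightarrow> norm (A t) \<le> M) \<Longrightarrow>
    norm (X - 1) \<le> exp (M * (y - x)) - 1"
proof (induction rule: Riemann_value.induct)
  case (step y X w \<xi>)
  have xy: "x \<le> y" using step.hyps(1) by (rule Riemann_value_le)
  have IH: "norm (X - 1) \<le> exp (M * (y - x)) - 1" using step by auto
  have \<xi>: "norm (A \<xi>) \<le> M" using step xy by auto
  have "(1 + (w - y) *\<^sub>R A \<xi>) * X - 1 = (1 + (w - y) *\<^sub>R A \<xi>) * (X - 1) + (w - y) *\<^sub>R A \<xi>"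
    by (simp add: algebra_simps)
  also have "norm \<dots> \<le> norm (1 + (w - y) *\<^sub>R A \<xi>) * norm (X - 1) + (w - y) * norm (A \<xi>)"
    using step by (intro norm_triangle_mono norm_mult_ineq) auto
  also have "\<dots> \<le> exp (M * (w - y)) * (exp (M * (y - x)) - 1) + (w - y) * M"
    using step \<xi> by (intro add_mono mult_mono IH norm_one_plus_scaleR_le mult_left_mono) auto
  also have "\<dots> \<le> exp (M * (w - y)) * (exp (M * (y - x)) - 1) + (exp (M * (w - y)) - 1)"
    using exp_ge_add_one_self[of "M * (w - y)"] unfolding mult.commute[of "w - y" M] by linarith
  also have "\<dots> = exp (M * (w - x)) - 1"
    by (simp add: exp_add[symmetric] algebra_simps)
  finally show ?case .
qed simp

lemma Riemann_value_inverse: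
  fixes A :: "real \<Rightarrow> 'a::{real_normed_algebra_1, banach}"
  shows "Riemann_value A \<delta> x y X \<Longrightarrow> (\<And>t. t \<in> {x..y} \<Longrightarrow> norm (A t) \<le> M) \<Longrightarrow> 4 * M * \<delta> \<le> 1 \<Longrightarrow>
    \<exists>Y. X * Y = 1 \<and> Y * X = 1 \<and> norm Y \<le> exp (2 * M * (y - x))"
proof (induction rule: Riemann_value.induct)
  case refl
  show ?case by (rule exI[of _ 1]) simp
next
  case (step y X w \<xi>)
  have xy: "x \<le> y" using step.hyps(1) by (rule Riemann_value_le)
  have \<xi>: "norm (A \<xi>) \<le> M" using step xy by auto
  have "0 \<le> M" using norm_ge_zero \<xi> by (rule order_trans)
  obtain Y where Y: "X * Y = 1" "Y * X = 1" "norm Y \<le> exp (2 * M * (y - x))"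
    using step by auto
  have le: "norm ((w - y) *\<^sub>R A \<xi>) \<le> (w - y) * M"
    using step \<xi> by (simp add: mult_left_mono)
  \<comment> \<open>Both endpoints lie within \<delta> of the tag, so the interval is shorter than
    \<open>2 * \<delta>\<close>; together with \<open>4 * M * \<delta> \<le> 1\<close> this brings
    the factor into the range of the Neumann series.\<close>
  also have "\<dots> \<le> 2 * \<delta> * M"
    using step \<open>0 \<le> M\<close> by (intro mult_right_mono) auto
  also have "\<dots> \<le> 1 / 2"
    using step.prems(2) by (simp add: mult.commute mult.left_commute)
  finally obtain G where G: "(1 + (w - y) *\<^sub>R A \<xi>) * G = 1" "G * (1 + (w - y) *\<^sub>R A \<xi>) = 1"
      "norm G \<le> exp (2 * norm ((w - y) *\<^sub>R A \<xi>))"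
    using one_plus_inverse_exp_bound by blast
  have "norm G \<le> exp (2 * M * (w - y))"
    using G(3) by (rule order_trans) (use le in \<open>simp add: mult.commute\<close>)
  then have "norm Y * norm G \<le> exp (2 * M * (y - x)) * exp (2 * M * (w - y))"
    using Y(3) by (intro mult_mono) auto
  also have "\<dots> = exp (2 * M * (w - x))"
    by (simp add: exp_add[symmetric] algebra_simps)
  finally have "norm (Y * G) \<le> exp (2 * M * (w - x))"
    using norm_mult_ineq order_trans by blast
  moreover have "((1 + (w - y) *\<^sub>R A \<xi>) * X) * (Y * G) = 1" "(Y * G) * ((1 + (w - y) *\<^sub>R A \<xi>) * X) = 1"
    using G(1,2) Y(1,2) by (metis mult.assoc mult.left_neutral)+
  ultimately show ?case by blast
qed

section \<open>Splitting a fine product at a given point\<close>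

text \<open>Only the interval that straddles \<open>c\<close> has to be cut. Its two parts are
  retagged by \<open>c\<close>, which doubles the fineness and changes the product by an amount that
  vanishes with \<delta>, by boundedness alone and without continuity.\<close>

lemma Riemann_value_split:
  "Riemann_value A \<delta> x y X \<Longrightarrow> (\<And>t. t \<in> {x..y} \<Longrightarrow> norm (A t) \<le> M) \<Longrightarrow> x \<le> c \<Longrightarrow> c \<le> y \<Longrightarrow> 0 < \<delta> \<Longrightarrow>
    \<exists>X1 X2. Riemann_value A (2 * \<delta>) x c X1 \<and> Riemann_value A (2 * \<delta>) c y X2 \<and>
      norm (X - X2 * X1) \<le> (4 * M * \<delta> + 4 * M\<^sup>2 * \<delta>\<^sup>2) * exp (M * (y - x))"
proof (induction arbitrary: c rule: Riemann_value.induct)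
  case refl
  have "0 \<le> M" using norm_ge_zero refl.prems(1)[of x] by (rule order_trans) simp
  then show ?case
    using refl by (intro exI[of _ 1]) (auto intro: Riemann_value.refl)
next
  case (step y X w \<xi>)
  define K where "K = 4 * M * \<delta> + 4 * M\<^sup>2 * \<delta>\<^sup>2"
  let ?F = "1 + (w - y) *\<^sub>R A \<xi>"
  have xy: "x \<le> y" using step.hyps(1) by (rule Riemann_value_le)
  have \<xi>: "norm (A \<xi>) \<le> M" using step xy by auto
  have "0 \<le> M" using norm_ge_zero \<xi> by (rule order_trans)
  then have "0 \<le> K" using step.prems by (simp add: K_def)
  have X: "Riemann_value A (2 * \<delta>) x y X"
    by (rule Riemann_value_mono[OF step.hyps(1)]) (use step.prems in simp)
  \<comment> \<open>The last interval lies to the right of \<open>c\<close>, straddles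
    \<open>c\<close>, or ends at \<open>c\<close>. The first case multiplies the inherited error by
    at most \<open>exp (M * (w - y))\<close>, the second creates the error \<open>K\<close>, the
    third is exact.\<close>
  consider "c \<le> y" | "y < c" "c < w" | "c = w"
    using step.prems by linarith
  then show ?case
  proof cases
    case 1
    then obtain X1 X2 where X12: "Riemann_value A (2 * \<delta>) x c X1" "Riemann_value A (2 * \<delta>) c y X2"
        "norm (X - X2 * X1) \<le> K * exp (M * (y - x))"
      using step.IH[of c] step.prems step.hyps by (auto simp: K_def)
    have "Riemann_value A (2 * \<delta>) c w (?F * X2)"
      using step by (intro Riemann_value.step[OF X12(2)]) auto
    moreover have "norm (?F * X - ?F * X2 * X1) \<le> K * exp (M * (w - x))"
    proof -
      have "norm (?F * X - ?F * X2 * X1) \<le> norm ?F * norm (X - X2 * X1)"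
        by (simp add: mult.assoc right_diff_distrib[symmetric] norm_mult_ineq)
      also have "\<dots> \<le> exp (M * (w - y)) * (K * exp (M * (y - x)))"
        using step X12(3) \<xi> by (intro mult_mono norm_one_plus_scaleR_le) auto
      also have "\<dots> = K * exp (M * (w - x))"
        by (simp add: exp_add[symmetric] algebra_simps)
      finally show ?thesis .
    qed
    ultimately show ?thesis
      using X12(1) unfolding K_def by blast
  next
    case 2
    \<comment> \<open>The tag \<open>c\<close> belongs to both parts, and
      \<open>w - y < 2 * \<delta>\<close> makes both of them
      \<open>2 * \<delta>\<close>-fine.\<close>
    define F1 F2 where "F1 = 1 + (c - y) *\<^sub>R A c" and "F2 = 1 + (w - c) *\<^sub>R A c"
    have F1: "Riemann_value A (2 * \<delta>) x c (F1 * X)"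
      unfolding F1_def using step 2 by (intro Riemann_value.step[OF X]) auto
    have F2: "Riemann_value A (2 * \<delta>) c w F2"
      unfolding F2_def using step 2 by (intro Riemann_value_single) auto
    have c: "norm (A c) \<le> M" using step xy 2 by auto
    have "?F - F2 * F1 = (w - y) *\<^sub>R A \<xi> - ((w - y) *\<^sub>R A c + ((w - c) * (c - y)) *\<^sub>R (A c * A c))"
      by (simp add: F1_def F2_def algebra_simps)
    also have "norm \<dots> \<le> (w - y) * norm (A \<xi>) + ((w - y) * norm (A c) + (w - c) * (c - y) * norm (A c * A c))"
      using step 2 by (intro norm_triangle_le_diff add_mono norm_triangle_le) auto
    \<comment> \<open>All three lengths are below \<open>2 * \<delta>\<close>; this is where the
      constant \<open>K\<close> comes from.\<close>
    also have "\<dots> \<le> (2 * \<delta>) * M + ((2 * \<delta>) * M + (2 * \<delta>) * (2 * \<delta>) * (M * M))"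
      using step 2 \<xi> c \<open>0 \<le> M\<close>
      by (intro add_mono mult_mono order_trans[OF norm_mult_ineq]) auto
    also have "\<dots> = K"
      by (simp add: K_def power2_eq_square algebra_simps)
    finally have "norm (?F - F2 * F1) \<le> K" .
    moreover have "norm X \<le> exp (M * (w - x))"
    proof (rule order_trans)
      show "norm X \<le> exp (M * (y - x))"
        using step by (intro Riemann_value_norm_le[of A \<delta>]) auto
      show "exp (M * (y - x)) \<le> exp (M * (w - x))"
        using step \<open>0 \<le> M\<close> by (simp add: mult_left_mono)
    qed
    ultimately have "norm (?F - F2 * F1) * norm X \<le> K * exp (M * (w - x))"
      using \<open>0 \<le> K\<close> by (intro mult_mono) auto
    moreover have "norm (?F * X - F2 * (F1 * X)) \<le> norm (?F - F2 * F1) * norm X"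
      by (metis left_diff_distrib mult.assoc norm_mult_ineq)
    ultimately show ?thesis
      using F1 F2 unfolding K_def by (meson order_trans)
  next
    case 3
    have "Riemann_value A (2 * \<delta>) x w (?F * X)"
      using step by (intro Riemann_value.step[OF X]) auto
    then show ?thesis
      unfolding 3 using \<open>0 \<le> K\<close> K_def
      by (intro exI[of _ "?F * X"] exI[of _ 1]) (auto intro: Riemann_value.refl)
  qed
qed

lemma Riemann_value_split_small:
  assumes "\<And>t. t \<in> {x..y} \<Longrightarrow> norm (A t) \<le> M" "x \<le> c" "c \<le> y" "0 < \<epsilon>" "0 < \<eta>"
  obtains \<delta> where "0 < \<delta>"
    "\<And>X. Riemann_value A \<delta> x y X \<Longrightarrow>
      \<exists>X1 X2. Riemann_value A \<eta> x c X1 \<and> Riemann_value A \<eta> c y X2 \<and> norm (X - X2 * X1) \<le> \<epsilon>"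
proof -
  have "0 \<le> M" using norm_ge_zero assms(1)[of x] by (rule order_trans) (use assms in auto)
  define e where "e = exp (M * (y - x))"
  have "((\<lambda>\<delta>. (4 * M * \<delta> + 4 * M\<^sup>2 * \<delta>\<^sup>2) * e) \<longlongrightarrow> (4 * M * 0 + 4 * M\<^sup>2 * 0\<^sup>2) * e) (at_right 0)"
    by (intro tendsto_intros)
  then have "\<forall>\<^sub>F \<delta> in at_right 0. (4 * M * \<delta> + 4 * M\<^sup>2 * \<delta>\<^sup>2) * e < \<epsilon>"
    using \<open>0 < \<epsilon>\<close> by (simp add: order_tendstoD(2))
  \<comment> \<open>Half of \<eta>, because splitting yields \<open>2 * \<delta>\<close>-fine
    pieces.\<close>
  moreover have "\<forall>\<^sub>F \<delta> in at_right 0. \<delta> < \<eta> / 2"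
    using \<open>0 < \<eta>\<close> by (intro order_tendstoD(2)[OF tendsto_ident_at]) auto
  moreover have "\<forall>\<^sub>F \<delta> in at_right (0::real). 0 < \<delta>"
    by (rule eventually_at_right_less)
  ultimately have "\<forall>\<^sub>F \<delta> in at_right 0. (4 * M * \<delta> + 4 * M\<^sup>2 * \<delta>\<^sup>2) * e < \<epsilon> \<and> \<delta> < \<eta> / 2 \<and> 0 < \<delta>"
    by eventually_elim auto
  then obtain \<delta> where \<delta>: "(4 * M * \<delta> + 4 * M\<^sup>2 * \<delta>\<^sup>2) * e < \<epsilon>" "\<delta> < \<eta> / 2" "0 < \<delta>"
    using eventually_happens'[OF trivial_limit_at_right_real] by blast
  show thesis
  proof (rule that[OF \<delta>(3)])
    fix X assume "Riemann_value A \<delta> x y X"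
    then obtain X1 X2 where "Riemann_value A (2 * \<delta>) x c X1" "Riemann_value A (2 * \<delta>) c y X2"
        "norm (X - X2 * X1) \<le> (4 * M * \<delta> + 4 * M\<^sup>2 * \<delta>\<^sup>2) * e"
      using Riemann_value_split[of A \<delta> x y X M c] assms \<delta>(3) unfolding e_def by blast
    moreover from \<delta> have "2 * \<delta> \<le> \<eta>" by simp
    ultimately show "\<exists>X1 X2. Riemann_value A \<eta> x c X1 \<and> Riemann_value A \<eta> c y X2 \<and> norm (X - X2 * X1) \<le> \<epsilon>"
      using \<delta>(1) by (meson Riemann_value_mono order_trans less_imp_le)
  qed
qed

section \<open>Constant functions and the exponential\<close>

text \<open>Differentiability of the exponential along \<open>w\<close> at 0. An error proportional
  to \<open>h\<close> is essential: summed over a partition it stays below \<epsilon> times the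
  total length.\<close>

lemma exp_linear_approx:
  fixes w :: "'a::{real_normed_algebra_1, banach}"
  assumes "0 < \<epsilon>"
  obtains d where "0 < d"
    "\<And>h. 0 \<le> h \<Longrightarrow> h < d \<Longrightarrow> norm ((1 + h *\<^sub>R w) - exp (h *\<^sub>R w)) \<le> \<epsilon> * h"
proof -
  have "((\<lambda>h. exp (h *\<^sub>R w)) has_derivative (\<lambda>h. h *\<^sub>R w)) (at 0)"
    using exp_scaleR_has_vector_derivative_right[of w 0 UNIV] by (simp add: has_vector_derivative_def)
  then obtain d where d: "0 < d" "\<And>h. norm h < d \<Longrightarrow> norm (exp (h *\<^sub>R w) - 1 - h *\<^sub>R w) \<le> \<epsilon> * norm h"
    using assms unfolding has_derivative_at_alt by (auto simp del: real_norm_def)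
  show thesis
  proof (rule that[OF d(1)])
    fix h :: real assume "0 \<le> h" "h < d"
    then show "norm ((1 + h *\<^sub>R w) - exp (h *\<^sub>R w)) \<le> \<epsilon> * h"
      using d(2)[of h] by (simp add: norm_minus_commute diff_diff_eq)
  qed
qed

text \<open>Exponentials of multiples of the same \<open>z\<close> multiply exactly, so only the
  local errors of the factors accumulate. The hypothesis covers steps below
  \<open>2 * \<delta>\<close> since that bounds the intervals of a \<delta>-fine partition.\<close>

lemma Riemann_value_const_approx:
  fixes A :: "real \<Rightarrow> 'a::{real_normed_algebra_1, banach}"
  assumes "\<And>h. 0 \<le> h \<Longrightarrow> h < 2 * \<delta> \<Longrightarrow> norm ((1 + h *\<^sub>R z) - exp (h *\<^sub>R z)) \<le> \<epsilon> * h" "0 \<le> \<epsilon>"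
  shows "Riemann_value A \<delta> x y X \<Longrightarrow> (\<And>t. t \<in> {x..y} \<Longrightarrow> A t = z) \<Longrightarrow>
    norm (X - exp ((y - x) *\<^sub>R z)) \<le> \<epsilon> * (y - x) * exp (norm z * (y - x))"
proof (induction rule: Riemann_value.induct)
  case (step y X w \<xi>)
  have xy: "x \<le> y" using step.hyps(1) by (rule Riemann_value_le)
  have \<xi>: "A \<xi> = z" using step xy by auto
  have IH: "norm (X - exp ((y - x) *\<^sub>R z)) \<le> \<epsilon> * (y - x) * exp (norm z * (y - x))"
    using step by auto
  define E where "E = exp ((y - x) *\<^sub>R z)"
  have "(w - x) *\<^sub>R z = (w - y) *\<^sub>R z + (y - x) *\<^sub>R z"
    by (simp add: scaleR_add_left[symmetric])
  then have ex: "exp ((w - x) *\<^sub>R z) = exp ((w - y) *\<^sub>R z) * E"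
    unfolding E_def by (simp add: exp_add_commuting)
  have E: "norm E \<le> exp (norm z * (y - x))"
    unfolding E_def using norm_exp[of "(y - x) *\<^sub>R z"] xy by (simp add: mult.commute)
  have "(1 + (w - y) *\<^sub>R z) * X - exp ((w - x) *\<^sub>R z) =
      (1 + (w - y) *\<^sub>R z) * (X - E) + ((1 + (w - y) *\<^sub>R z) - exp ((w - y) *\<^sub>R z)) * E"
    unfolding ex by (simp add: algebra_simps)
  also have "norm \<dots> \<le> norm (1 + (w - y) *\<^sub>R z) * norm (X - E) +
      norm ((1 + (w - y) *\<^sub>R z) - exp ((w - y) *\<^sub>R z)) * norm E"
    by (intro norm_triangle_mono norm_mult_ineq)
  also have "\<dots> \<le> exp (norm z * (w - y)) * (\<epsilon> * (y - x) * exp (norm z * (y - x))) +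
      (\<epsilon> * (w - y)) * exp (norm z * (y - x))"
    using step IH E assms \<open>0 \<le> \<epsilon>\<close> unfolding E_def[symmetric]
    by (intro add_mono mult_mono norm_one_plus_scaleR_le) auto
  also have "\<dots> = \<epsilon> * (y - x) * exp (norm z * (w - x)) + \<epsilon> * (w - y) * exp (norm z * (y - x))"
    by (simp add: exp_add[symmetric] algebra_simps)
  also have "\<dots> \<le> \<epsilon> * (y - x) * exp (norm z * (w - x)) + \<epsilon> * (w - y) * exp (norm z * (w - x))"
    using step \<open>0 \<le> \<epsilon>\<close> by (intro add_left_mono mult_left_mono) (auto intro: mult_left_mono)
  also have "\<dots> = \<epsilon> * (w - x) * exp (norm z * (w - x))"
    by (simp add: algebra_simps)
  finally show ?case unfolding \<xi> .
qed simp

section \<open>The Cauchy criterion and its passage to larger intervals\<close>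

text \<open>Mentions neither a limit nor its invertibility, so that subintervals can be glued first
  and the limit taken once at the end.\<close>

definition Cauchy_Riemann_product :: "(real \<Rightarrow> 'a::real_normed_algebra_1) \<Rightarrow> real \<Rightarrow> real \<Rightarrow> bool"
  where "Cauchy_Riemann_product A x y \<longleftrightarrow> (\<forall>\<epsilon>>0. \<exists>\<delta>>0. \<forall>X Y.
    Riemann_value A \<delta> x y X \<longrightarrow> Riemann_value A \<delta> x y Y \<longrightarrow> norm (X - Y) \<le> \<epsilon>)"

lemma Cauchy_Riemann_product_const:
  fixes A :: "real \<Rightarrow> 'a::{real_normed_algebra_1, banach}"
  assumes "\<And>t. t \<in> {x..y} \<Longrightarrow> A t = z" "x \<le> y"
  shows "Cauchy_Riemann_product A x y"
  unfolding Cauchy_Riemann_product_def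
proof (intro allI impI)
  fix \<epsilon> :: real assume "0 < \<epsilon>"
  \<comment> \<open>The summand 1 keeps \<open>L\<close> positive for \<open>x = y\<close>. With
    \<epsilon> / (2 * L) every product is within \<epsilon> / 2 of the exponential.\<close>
  define L where "L = 1 + (y - x) * exp (norm z * (y - x))"
  have L: "0 < L" using assms(2) by (simp add: L_def add_pos_nonneg)
  then have \<epsilon>': "0 < \<epsilon> / (2 * L)" using \<open>0 < \<epsilon>\<close> by simp
  then obtain d where d: "0 < d"
      "\<And>h. 0 \<le> h \<Longrightarrow> h < d \<Longrightarrow> norm ((1 + h *\<^sub>R z) - exp (h *\<^sub>R z)) \<le> \<epsilon> / (2 * L) * h"
    using exp_linear_approx by blast
  have *: "norm (X - exp ((y - x) *\<^sub>R z)) \<le> \<epsilon> / 2" if "Riemann_value A (d / 2) x y X" for X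
  proof -
    have "norm (X - exp ((y - x) *\<^sub>R z)) \<le> \<epsilon> / (2 * L) * (y - x) * exp (norm z * (y - x))"
      by (rule Riemann_value_const_approx[OF _ _ that]) (use d(2) \<epsilon>' assms(1) in auto)
    also have "\<dots> \<le> \<epsilon> / (2 * L) * L"
      unfolding mult.assoc using \<epsilon>' by (intro mult_left_mono) (auto simp: L_def)
    finally show ?thesis using L by simp
  qed
  show "\<exists>\<delta>>0. \<forall>X Y. Riemann_value A \<delta> x y X \<longrightarrow> Riemann_value A \<delta> x y Y \<longrightarrow> norm (X - Y) \<le> \<epsilon>"
  proof (intro exI[of _ "d / 2"] conjI allI impI)
    fix X Y assume "Riemann_value A (d / 2) x y X" "Riemann_value A (d / 2) x y Y"
    from this[THEN *] show "norm (X - Y) \<le> \<epsilon>"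
      using norm_triangle_ineq4[of "X - exp ((y - x) *\<^sub>R z)" "Y - exp ((y - x) *\<^sub>R z)"] by simp
  qed (use d in simp)
qed

lemma norm_mult_diff_le:
  fixes X1 X2 Y1 Y2 :: "'a::real_normed_algebra"
  shows "norm (X2 * X1 - Y2 * Y1) \<le> norm X2 * norm (X1 - Y1) + norm (X2 - Y2) * norm Y1"
proof -
  have "X2 * X1 - Y2 * Y1 = X2 * (X1 - Y1) + (X2 - Y2) * Y1"
    by (simp add: algebra_simps)
  also have "norm \<dots> \<le> norm X2 * norm (X1 - Y1) + norm (X2 - Y2) * norm Y1"
    by (intro norm_triangle_mono norm_mult_ineq)
  finally show ?thesis .
qed

text \<open>On the right only one fixed tolerance is assumed. This serves both the gluing of two
  intervals and a limit point, where the right piece is merely short.\<close>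

lemma Cauchy_Riemann_product_if_split:
  assumes M: "\<And>t. t \<in> {x..y} \<Longrightarrow> norm (A t) \<le> M" and c: "x \<le> c" "c \<le> y"
    and right: "\<And>X Y. Riemann_value A \<eta> c y X \<Longrightarrow> Riemann_value A \<eta> c y Y \<Longrightarrow> norm (X - Y) \<le> \<epsilon>"
    and left: "Cauchy_Riemann_product A x c"
    and pos: "0 < \<eta>" "0 < \<epsilon>"
  shows "\<exists>\<delta>>0. \<forall>X Y. Riemann_value A \<delta> x y X \<longrightarrow> Riemann_value A \<delta> x y Y \<longrightarrow>
    norm (X - Y) \<le> 4 * exp (M * (y - x)) * \<epsilon>"
proof -
  have "0 \<le> M" using norm_ge_zero M[of x] by (rule order_trans) (use c in auto)
  define K where "K = exp (M * (y - x))"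
  have K: "1 \<le> K" "exp (M * (c - x)) \<le> K" "exp (M * (y - c)) \<le> K"
    using \<open>0 \<le> M\<close> c by (auto simp: K_def intro!: mult_left_mono)
  obtain \<delta>1 where \<delta>1: "0 < \<delta>1"
      "\<And>X Y. Riemann_value A \<delta>1 x c X \<Longrightarrow> Riemann_value A \<delta>1 x c Y \<Longrightarrow> norm (X - Y) \<le> \<epsilon>"
    using left pos unfolding Cauchy_Riemann_product_def by meson
  \<comment> \<open>The minimum makes the pieces fine enough for the estimates on both sides of
    \<open>c\<close>.\<close>
  obtain \<delta> where \<delta>: "0 < \<delta>"
    "\<And>X. Riemann_value A \<delta> x y X \<Longrightarrow>
      \<exists>X1 X2. Riemann_value A (min \<delta>1 \<eta>) x c X1 \<and> Riemann_value A (min \<delta>1 \<eta>) c y X2 \<and> norm (X - X2 * X1) \<le> \<epsilon>"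
    using Riemann_value_split_small[of x y A M c \<epsilon> "min \<delta>1 \<eta>"] M c pos \<delta>1(1) by auto
  show ?thesis
  proof (intro exI[of _ \<delta>] conjI allI impI)
    fix X Y assume "Riemann_value A \<delta> x y X" "Riemann_value A \<delta> x y Y"
    then obtain X1 X2 Y1 Y2 where
        "Riemann_value A (min \<delta>1 \<eta>) x c X1" "Riemann_value A (min \<delta>1 \<eta>) c y X2" and X: "norm (X - X2 * X1) \<le> \<epsilon>"
      and "Riemann_value A (min \<delta>1 \<eta>) x c Y1" "Riemann_value A (min \<delta>1 \<eta>) c y Y2" and Y: "norm (Y - Y2 * Y1) \<le> \<epsilon>"
      using \<delta>(2) by meson
    then have rv: "Riemann_value A \<delta>1 x c X1" "Riemann_value A \<delta>1 x c Y1"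
        "Riemann_value A \<eta> c y X2" "Riemann_value A \<eta> c y Y2"
      by (auto intro: Riemann_value_mono)
    have "norm X2 \<le> K"
      using M c by (intro order_trans[OF Riemann_value_norm_le[OF rv(3)] K(3)]) auto
    moreover have "norm Y1 \<le> K"
      using M c by (intro order_trans[OF Riemann_value_norm_le[OF rv(2)] K(2)]) auto
    ultimately have "norm X2 * norm (X1 - Y1) + norm (X2 - Y2) * norm Y1 \<le> K * \<epsilon> + \<epsilon> * K"
      using \<delta>1(2)[OF rv(1,2)] right[OF rv(3,4)] K pos by (intro add_mono mult_mono) auto
    then have "norm (X2 * X1 - Y2 * Y1) \<le> 2 * K * \<epsilon>"
      using norm_mult_diff_le[of X2 X1 Y2 Y1] by simp
    then have "norm ((X - X2 * X1) + (X2 * X1 - Y2 * Y1) + (Y2 * Y1 - Y)) \<le> \<epsilon> + 2 * K * \<epsilon> + \<epsilon>"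
      using X Y by (intro norm_triangle_mono) (auto simp: norm_minus_commute)
    \<comment> \<open>Two splitting errors of \<epsilon> each and \<open>2 * K * \<epsilon>\<close>
      from exchanging both factors, combined by \<open>1 \<le> K\<close>.\<close>
    also have "\<dots> \<le> 4 * K * \<epsilon>"
      using mult_right_mono[OF K(1), of \<epsilon>] pos by simp
    finally show "norm (X - Y) \<le> 4 * exp (M * (y - x)) * \<epsilon>"
      by (simp add: K_def)
  qed (rule \<delta>(1))
qed

lemma Cauchy_Riemann_product_trans:
  assumes M: "\<And>t. t \<in> {x..y} \<Longrightarrow> norm (A t) \<le> M" and c: "x \<le> c" "c \<le> y"
    and "Cauchy_Riemann_product A x c" "Cauchy_Riemann_product A c y"
  shows "Cauchy_Riemann_product A x y"
  unfolding Cauchy_Riemann_product_def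
proof (intro allI impI)
  fix \<epsilon> :: real assume "0 < \<epsilon>"
  \<comment> \<open>Cancels the factor lost in
    \<open>Cauchy_Riemann_product_if_split\<close>.\<close>
  define \<epsilon>' where "\<epsilon>' = \<epsilon> / (4 * exp (M * (y - x)))"
  have "0 < \<epsilon>'" using \<open>0 < \<epsilon>\<close> by (simp add: \<epsilon>'_def)
  then obtain \<eta> where "0 < \<eta>"
      "\<And>X Y. Riemann_value A \<eta> c y X \<Longrightarrow> Riemann_value A \<eta> c y Y \<Longrightarrow> norm (X - Y) \<le> \<epsilon>'"
    using assms(5) unfolding Cauchy_Riemann_product_def by meson
  with Cauchy_Riemann_product_if_split[of x y A M c \<eta> \<epsilon>'] M c assms(4) \<open>0 < \<epsilon>'\<close>
  show "\<exists>\<delta>>0. \<forall>X Y. Riemann_value A \<delta> x y X \<longrightarrow> Riemann_value A \<delta> x y Y \<longrightarrow> norm (X - Y) \<le> \<epsilon>"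
    by (simp add: \<epsilon>'_def)
qed

text \<open>For \<open>c\<close> close to \<open>y\<close> all products over the remaining interval
  are near \<open>1\<close>, hence near each other, so the criterion on the left of \<open>c\<close>
  suffices.\<close>

lemma Cauchy_Riemann_product_limit:
  assumes M: "\<And>t. t \<in> {x..y} \<Longrightarrow> norm (A t) \<le> M" and "x < y"
    and left: "\<And>c. x \<le> c \<Longrightarrow> c < y \<Longrightarrow> Cauchy_Riemann_product A x c"
  shows "Cauchy_Riemann_product A x y"
  unfolding Cauchy_Riemann_product_def
proof (intro allI impI)
  fix \<epsilon> :: real assume "0 < \<epsilon>"
  define \<epsilon>' where "\<epsilon>' = \<epsilon> / (4 * exp (M * (y - x)))"
  have "0 < \<epsilon>'" using \<open>0 < \<epsilon>\<close> by (simp add: \<epsilon>'_def)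
  have "((\<lambda>c. exp (M * (y - c)) - 1) \<longlongrightarrow> exp (M * (y - y)) - 1) (at_left y)"
    by (intro tendsto_intros)
  then have "\<forall>\<^sub>F c in at_left y. exp (M * (y - c)) - 1 < \<epsilon>' / 2"
    using \<open>0 < \<epsilon>'\<close> by (intro order_tendstoD(2)) auto
  moreover have "\<forall>\<^sub>F c in at_left y. c \<in> {x<..<y}"
    using \<open>x < y\<close> by (rule eventually_at_left_real)
  ultimately have "\<forall>\<^sub>F c in at_left y. exp (M * (y - c)) - 1 < \<epsilon>' / 2 \<and> c \<in> {x<..<y}"
    by eventually_elim simp
  then obtain c where c: "exp (M * (y - c)) - 1 < \<epsilon>' / 2" "x < c" "c < y"
    using eventually_happens'[OF trivial_limit_at_left_real] by fastforce
  have *: "norm (X - 1) \<le> \<epsilon>' / 2" if "Riemann_value A 1 c y X" for X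
    using Riemann_value_diff_one_le[OF that, of M] M c by fastforce
  \<comment> \<open>Fineness 1 is an arbitrary choice: the estimate depends only on the length
    \<open>y - c\<close>.\<close>
  have right: "norm (X - Y) \<le> \<epsilon>'" if "Riemann_value A 1 c y X" "Riemann_value A 1 c y Y" for X Y
    using *[OF that(1)] *[OF that(2)] norm_triangle_ineq4[of "X - 1" "Y - 1"] by simp
  with Cauchy_Riemann_product_if_split[of x y A M c 1 \<epsilon>'] M c left[of c] \<open>0 < \<epsilon>'\<close>
  show "\<exists>\<delta>>0. \<forall>X Y. Riemann_value A \<delta> x y X \<longrightarrow> Riemann_value A \<delta> x y Y \<longrightarrow> norm (X - Y) \<le> \<epsilon>"
    by (simp add: \<epsilon>'_def)
qed

section \<open>From the Cauchy criterion to an invertible limit\<close>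

lemma Riemann_product_integrable_if_Cauchy:
  fixes A :: "real \<Rightarrow> 'a::{real_normed_algebra_1, banach}"
  assumes M: "\<And>t. t \<in> {a..b} \<Longrightarrow> norm (A t) \<le> M" and "a \<le> b"
    and Cauchy: "Cauchy_Riemann_product A a b"
  shows "Riemann_product_integrable A a b"
proof -
  define d where "d n = 1 / real (Suc n)" for n
  have "\<exists>X. Riemann_value A (d n) a b X" for n
    using \<open>a \<le> b\<close> by (intro Riemann_value_exists) (simp_all add: d_def)
  then obtain X where X: "Riemann_value A (d n) a b (X n)" for n
    by metis
  have small: "\<forall>\<^sub>F n in sequentially. Riemann_value A \<delta> a b (X n)" if "0 < \<delta>" for \<delta>
  proof -
    have "d \<longlonglongrightarrow> 0"
      unfolding d_def by (rule LIMSEQ_Suc[OF lim_1_over_n])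
    then have "\<forall>\<^sub>F n in sequentially. d n < \<delta>"
      using that by (rule order_tendstoD)
    then show ?thesis
      by eventually_elim (use X Riemann_value_mono less_imp_le in blast)
  qed
  have "Cauchy X"
  proof (rule metric_CauchyI)
    fix \<epsilon> :: real assume "0 < \<epsilon>"
    then obtain \<delta> where \<delta>: "0 < \<delta>"
        "\<And>X Y. Riemann_value A \<delta> a b X \<Longrightarrow> Riemann_value A \<delta> a b Y \<Longrightarrow> norm (X - Y) \<le> \<epsilon> / 2"
      using Cauchy unfolding Cauchy_Riemann_product_def by (meson half_gt_zero)
    obtain N where "\<And>n. N \<le> n \<Longrightarrow> Riemann_value A \<delta> a b (X n)"
      using small[OF \<delta>(1)] unfolding eventually_sequentially by blast
    with \<delta>(2) have "norm (X m - X n) \<le> \<epsilon> / 2" if "N \<le> m" "N \<le> n" for m n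
      using that by blast
    with \<open>0 < \<epsilon>\<close> show "\<exists>N. \<forall>m\<ge>N. \<forall>n\<ge>N. dist (X m) (X n) < \<epsilon>"
      by (intro exI[of _ N]) (fastforce simp: dist_norm)
  qed
  then obtain P where P: "X \<longlonglongrightarrow> P"
    using Cauchy_convergent convergentD by blast
  have "\<exists>\<delta>>0. \<forall>Y. Riemann_value A \<delta> a b Y \<longrightarrow> norm (Y - P) < \<epsilon>" if "0 < \<epsilon>" for \<epsilon>
  proof -
    \<comment> \<open>Tolerance \<epsilon> / 2, since passing to the limit keeps only a non-strict
      inequality.\<close>
    obtain \<delta> where \<delta>: "0 < \<delta>"
        "\<And>X Y. Riemann_value A \<delta> a b X \<Longrightarrow> Riemann_value A \<delta> a b Y \<Longrightarrow> norm (X - Y) \<le> \<epsilon> / 2"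
      using Cauchy \<open>0 < \<epsilon>\<close> unfolding Cauchy_Riemann_product_def by (meson half_gt_zero)
    have "norm (Y - P) < \<epsilon>" if "Riemann_value A \<delta> a b Y" for Y
    proof -
      have "\<forall>\<^sub>F n in sequentially. norm (Y - X n) \<le> \<epsilon> / 2"
        using small[OF \<delta>(1)] by eventually_elim (use \<delta>(2) that in blast)
      then have "norm (Y - P) \<le> \<epsilon> / 2"
        by (intro tendsto_upperbound[OF tendsto_norm[OF tendsto_diff[OF tendsto_const P]]]) simp_all
      with \<open>0 < \<epsilon>\<close> show ?thesis by simp
    qed
    with \<delta>(1) show ?thesis by blast
  qed
  moreover have "invertible_in_algebra P"
  proof -
    \<comment> \<open>Bounds the inverses of all sufficiently fine products at once, so some
      \<open>X n\<close> is close enough to \<open>P\<close> compared with its own inverse.\<close>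
    define K where "K = exp (2 * M * (b - a))"
    have "0 \<le> M" using norm_ge_zero M[of a] by (rule order_trans) (use \<open>a \<le> b\<close> in auto)
    define \<delta> where "\<delta> = 1 / (4 * M + 1)"
    have \<delta>: "0 < \<delta>" "4 * M * \<delta> \<le> 1"
      using \<open>0 \<le> M\<close> by (auto simp: \<delta>_def)
    have "(\<lambda>n. K * norm (X n - P)) \<longlonglongrightarrow> K * norm (P - P)"
      by (intro tendsto_intros P)
    then have "\<forall>\<^sub>F n in sequentially. K * norm (X n - P) < 1"
      by (intro order_tendstoD(2)) auto
    with small[OF \<delta>(1)] have "\<forall>\<^sub>F n in sequentially. Riemann_value A \<delta> a b (X n) \<and> K * norm (X n - P) < 1"
      by eventually_elim simp
    then obtain n where n: "Riemann_value A \<delta> a b (X n)" "K * norm (X n - P) < 1"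
      using eventually_happens'[OF sequentially_bot] by blast
    obtain Y where "X n * Y = 1" "Y * X n = 1" "norm Y \<le> K"
      using Riemann_value_inverse[OF n(1) M] \<delta>(2) unfolding K_def by blast
    then show ?thesis
      using n(2) by (rule invertible_in_algebra_near)
  qed
  ultimately show ?thesis
    unfolding Riemann_product_integrable_iff by blast
qed

section \<open>Boundedness of an integrable function\<close>

lemma bounded_if_Riemann_product_integrable:
  fixes A :: "real \<Rightarrow> 'a::{real_normed_algebra_1, banach}"
  assumes int: "Riemann_product_integrable A a b" and "a \<le> b"
  shows "bounded (A ` {a..b})"
proof -
  obtain P where P: "invertible_in_algebra P"
      "\<And>\<epsilon>. 0 < \<epsilon> \<Longrightarrow> \<exists>\<delta>>0. \<forall>X. Riemann_value A \<delta> a b X \<longrightarrow> norm (X - P) < \<epsilon>"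
    using int unfolding Riemann_product_integrable_iff by blast
  obtain Q where Q: "P * Q = 1" "Q * P = 1"
    using P(1) unfolding invertible_in_algebra_def by blast
  \<comment> \<open>This radius gives \<open>norm Q * norm (P - X) < 1\<close>, so every
    sufficiently fine product over the whole interval is invertible.\<close>
  have "0 < 1 / (norm Q + 1)"
    by (simp add: add_nonneg_pos)
  then obtain \<delta> where \<delta>: "0 < \<delta>"
      "\<And>X. Riemann_value A \<delta> a b X \<Longrightarrow> norm (X - P) < 1 / (norm Q + 1)"
    using P(2) by blast
  have inv: "invertible_in_algebra X" if "Riemann_value A \<delta> a b X" for X
  proof (rule invertible_in_algebra_near[OF Q order.refl])
    have "norm Q * norm (P - X) \<le> norm Q * (1 / (norm Q + 1))"
      using \<delta>(2)[OF that] by (intro mult_left_mono) (auto simp: norm_minus_commute)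
    also have "\<dots> < 1"
      using norm_ge_zero[of Q] by (simp add: divide_less_eq del: norm_ge_zero)
    finally show "norm Q * norm (P - X) < 1" .
  qed
  have ext: "bounded (A ` {a..y})"
    if bdd: "bounded (A ` {a..x})" and xy: "a \<le> x" "x \<le> c" "c \<le> y" "y \<le> b" "x < y"
      and near: "y - x < \<delta>" "(y - x) * norm (A c) \<le> 1 / 2" for x y c
  proof -
    obtain M where M: "\<And>t. t \<in> {a..x} \<Longrightarrow> norm (A t) \<le> M" "0 < M"
      using bdd unfolding bounded_pos by (metis imageI)
    \<comment> \<open>The second bound makes \<open>R\<close> invertible through
      \<open>Riemann_value_inverse\<close>.\<close>
    define \<delta>' where "\<delta>' = min \<delta> (1 / (4 * M))"
    have "0 < \<delta>'" using \<delta>(1) \<open>0 < M\<close> by (simp add: \<delta>'_def)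
    have "\<delta>' \<le> 1 / (4 * M)" by (simp add: \<delta>'_def)
    then have "4 * M * \<delta>' \<le> 1" using \<open>0 < M\<close> by (simp add: field_simps)
    obtain R where R': "Riemann_value A \<delta>' a x R"
      using Riemann_value_exists[OF \<open>0 < \<delta>'\<close> xy(1)] by blast
    then have R: "Riemann_value A \<delta> a x R"
      by (rule Riemann_value_mono) (simp add: \<delta>'_def)
    obtain V where V: "R * V = 1" "V * R = 1"
      using Riemann_value_inverse[OF R' M(1) \<open>4 * M * \<delta>' \<le> 1\<close>] by blast
    \<comment> \<open>Nothing is known about \<open>A\<close> beyond \<open>y\<close>; invertibility
      of \<open>L\<close> will follow by cancelling the other factors from a whole product with tag
      \<open>c\<close>.\<close>
    obtain L where L: "Riemann_value A \<delta> y b L"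
      using Riemann_value_exists[OF \<delta>(1) xy(4)] by blast
    define F where "F \<xi> = 1 + (y - x) *\<^sub>R A \<xi>" for \<xi>
    have prod: "Riemann_value A \<delta> a b (L * (F \<xi> * R))" if "\<xi> \<in> {x..y}" for \<xi>
      unfolding F_def using that xy near
      by (intro Riemann_value_append[OF L] Riemann_value.step[OF R]) auto
    have "invertible_in_algebra (L * (F c * R))"
      using prod xy inv by simp
    moreover have "invertible_in_algebra R"
      using V unfolding invertible_in_algebra_def by blast
    moreover have "invertible_in_algebra (F c)"
      unfolding F_def invertible_in_algebra_def
      using one_plus_inverse_exp_bound[of "(y - x) *\<^sub>R A c"] xy near by auto
    ultimately have "invertible_in_algebra L"
      using invertible_in_algebra_cancel_right invertible_in_algebra_mult by blast
    then obtain U where U: "L * U = 1" "U * L = 1"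
      unfolding invertible_in_algebra_def by blast
    \<comment> \<open>From \<open>F \<xi> = U * X * V\<close> with \<open>X\<close> a whole product
      near \<open>P\<close>. Since \<open>U\<close> and \<open>V\<close> are fixed, the bound is
      uniform in the tag \<xi>.\<close>
    define K where "K = norm U * (norm P + 1 / (norm Q + 1)) * norm V"
    have F_le: "norm (F \<xi>) \<le> K" if "\<xi> \<in> {x..y}" for \<xi>
    proof -
      define X where "X = L * (F \<xi> * R)"
      have "norm X \<le> norm P + 1 / (norm Q + 1)"
        using \<delta>(2)[OF prod[OF that]] norm_triangle_sub[of X P] unfolding X_def by simp
      then have "norm U * norm X * norm V \<le> K"
        unfolding K_def by (intro mult_left_mono mult_right_mono) auto
      moreover have "F \<xi> = U * X * V"
        unfolding X_def using U V by (metis mult.assoc mult.left_neutral mult.right_neutral)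
      moreover have "norm (U * X * V) \<le> norm U * norm X * norm V"
        by (rule order_trans[OF norm_mult_ineq]) (simp add: norm_mult_ineq mult_right_mono)
      ultimately show ?thesis by simp
    qed
    have "norm (A \<xi>) \<le> (K + 1) / (y - x)" if "\<xi> \<in> {x..y}" for \<xi>
    proof -
      have "(y - x) * norm (A \<xi>) = norm (F \<xi> - 1)"
        using xy by (simp add: F_def)
      also have "\<dots> \<le> K + 1"
        using norm_triangle_ineq4[of "F \<xi>" 1] F_le[OF that] by simp
      finally show ?thesis using xy by (simp add: field_simps)
    qed
    then have "bounded (A ` {x..y})"
      unfolding bounded_iff by blast
    moreover have "{a..y} = {a..x} \<union> {x..y}"
      using xy by auto
    ultimately show ?thesis
      using bdd by (simp add: image_Un)
  qed
  \<comment> \<open>Stated as an implication between bounds on initial segments, which is transitive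
    and thus fits \<open>Bolzano\<close>; at the end it is applied to the one-point segment at
    \<open>a\<close>.\<close>
  define Ext where "Ext x y \<longleftrightarrow> (a \<le> x \<longrightarrow> x \<le> y \<longrightarrow> y \<le> b \<longrightarrow> bounded (A ` {a..x}) \<longrightarrow> bounded (A ` {a..y}))"
    for x y
  have "Ext a b"
    using \<open>a \<le> b\<close>
  proof (rule Bolzano)
    fix x y w assume "Ext x y" "Ext y w" "x \<le> y" "y \<le> w"
    then show "Ext x w" unfolding Ext_def by auto
  next
    fix c assume c: "a \<le> c" "c \<le> b"
    \<comment> \<open>Short enough for any tag in \<open>{x..y}\<close> to be fine and for the
      factor with tag \<open>c\<close> to be invertible. Dependence on \<open>c\<close> is harmless,
      as \<open>Bolzano\<close> asks only for a local radius.\<close>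
    define d where "d = min \<delta> (1 / (2 * norm (A c) + 1))"
    have "0 < d" using \<delta>(1) by (simp add: d_def add_nonneg_pos)
    moreover have "Ext x y" if "x \<le> c" "c \<le> y" "y - x < d" for x y
      unfolding Ext_def
    proof (intro impI)
      assume *: "a \<le> x" "x \<le> y" "y \<le> b" "bounded (A ` {a..x})"
      have "(y - x) * (2 * norm (A c) + 1) \<le> 1"
        using that by (simp add: d_def pos_less_divide_eq add_nonneg_pos less_imp_le)
      then have "(y - x) * norm (A c) \<le> 1 / 2"
        using * by (simp add: algebra_simps)
      then show "bounded (A ` {a..y})"
        using ext[of x c y] * that by (cases "x = y") (auto simp: d_def)
    qed
    ultimately show "\<exists>d>0. \<forall>x y. x \<le> c \<and> c \<le> y \<and> y - x < d \<longrightarrow> Ext x y"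
      by blast
  qed
  then show ?thesis
    using \<open>a \<le> b\<close> by (simp add: Ext_def)
qed

section \<open>Step functions along a well-ordered set\<close>

theorem theorem4p4:
  fixes a b :: real
    and \<Lambda> :: "real set"
    and z :: "real \<Rightarrow> 'a::{real_normed_algebra_1, banach}"
    and A :: "real \<Rightarrow> 'a"
  assumes "a < b"
    and "\<Lambda> \<subseteq> {a..b}"
    and "well_order_on \<Lambda> {(x, y). x \<in> \<Lambda> \<and> y \<in> \<Lambda> \<and> x \<le> y}"
    and "a \<in> \<Lambda>" and "b \<in> \<Lambda>"
    and A_domain: "{a..<b} \<subseteq> (\<Union>\<alpha>\<in>{\<alpha>\<in>\<Lambda>. \<alpha> < b}. {\<alpha>..<succ_in \<Lambda> \<alpha>})"
    and A_step: "\<And>\<alpha> t. \<alpha> \<in> \<Lambda> \<Longrightarrow> \<alpha> < b \<Longrightarrow> t \<in> {\<alpha>..<succ_in \<Lambda> \<alpha>} \<Longrightarrow> A t = z \<alpha>"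
    and A_end: "A b = z b"
  shows "Riemann_product_integrable A a b \<longleftrightarrow> bounded (z ` \<Lambda>)"
proof -
  have wf: "wf {(x, y). x \<in> \<Lambda> \<and> y \<in> \<Lambda> \<and> x < y}"
  proof -
    have "{(x, y). x \<in> \<Lambda> \<and> y \<in> \<Lambda> \<and> x \<le> y} - Id = {(x, y). x \<in> \<Lambda> \<and> y \<in> \<Lambda> \<and> x < y}"
      by auto
    then show ?thesis
      using assms(3) by (simp add: well_order_on_def)
  qed
  have succ: "\<alpha> < succ_in \<Lambda> \<alpha>" if "\<alpha> \<in> \<Lambda>" "\<alpha> < b" for \<alpha>
  proof -
    \<comment> \<open>\<open>LEAST\<close> is informative only if a minimum exists; \<open>b\<close>
      makes the set nonempty and well-foundedness supplies the minimum.\<close>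
    have "b \<in> {\<beta> \<in> \<Lambda>. \<alpha> < \<beta>}"
      using \<open>b \<in> \<Lambda>\<close> \<open>\<alpha> < b\<close> by simp
    from wfE_min[OF wf this] obtain \<beta> where \<beta>: "\<beta> \<in> \<Lambda>" "\<alpha> < \<beta>"
        and min: "\<And>\<gamma>. (\<gamma>, \<beta>) \<in> {(x, y). x \<in> \<Lambda> \<and> y \<in> \<Lambda> \<and> x < y} \<Longrightarrow> \<gamma> \<notin> {\<beta> \<in> \<Lambda>. \<alpha> < \<beta>}"
      by (metis (no_types, lifting) mem_Collect_eq)
    have "succ_in \<Lambda> \<alpha> = \<beta>"
      unfolding succ_in_def
    proof (rule Least_equality)
      show "\<beta> \<le> \<gamma>" if "\<gamma> \<in> \<Lambda> \<and> \<alpha> < \<gamma>" for \<gamma>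
        using min[of \<gamma>] that \<beta>(1) by (cases "\<gamma> < \<beta>") auto
    qed (use \<beta> in simp)
    then show ?thesis using \<beta>(2) by simp
  qed
  have z_eq: "z \<alpha> = A \<alpha>" if "\<alpha> \<in> \<Lambda>" for \<alpha>
  proof (cases "\<alpha> = b")
    case False
    then have "\<alpha> < b" using that assms(2) by force
    then show ?thesis using A_step[of \<alpha> \<alpha>] succ[of \<alpha>] that by simp
  qed (simp add: A_end)
  \<comment> \<open>The step intervals cover all of \<open>{a..<b}\<close>, so boundedness of the
    family is boundedness of \<open>A\<close>, and both directions reduce to the general
    lemmas.\<close>
  have z_A: "z ` \<Lambda> = A ` {a..b}"
  proof
    show "z ` \<Lambda> \<subseteq> A ` {a..b}"
      using z_eq assms(2) by auto
    show "A ` {a..b} \<subseteq> z ` \<Lambda>"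
    proof
      fix u assume "u \<in> A ` {a..b}"
      then obtain t where t: "t \<in> {a..b}" "u = A t" by blast
      show "u \<in> z ` \<Lambda>"
      proof (cases "t = b")
        case True
        then show ?thesis using t A_end \<open>b \<in> \<Lambda>\<close> by simp
      next
        case False
        then have "t \<in> {a..<b}" using t by auto
        then obtain \<alpha> where "\<alpha> \<in> \<Lambda>" "\<alpha> < b" "t \<in> {\<alpha>..<succ_in \<Lambda> \<alpha>}"
          using A_domain by blast
        then show ?thesis using t A_step by blast
      qed
    qed
  qed
  show ?thesis
  proof
    assume "Riemann_product_integrable A a b"
    then show "bounded (z ` \<Lambda>)"
      unfolding z_A using \<open>a < b\<close> by (intro bounded_if_Riemann_product_integrable) auto
  next
    assume "bounded (z ` \<Lambda>)"
    then obtain M where M: "\<And>t. t \<in> {a..b} \<Longrightarrow> norm (A t) \<le> M"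
      unfolding z_A bounded_iff by (metis imageI)
    have "Cauchy_Riemann_product A a \<alpha>" if "\<alpha> \<in> \<Lambda>" for \<alpha>
      using that
    proof (induction \<alpha> rule: wf_induct_rule[OF wf])
      case (1 \<alpha>)
      then have \<alpha>: "a \<le> \<alpha>" "\<alpha> \<le> b" using assms(2) by auto
      show ?case
      proof (cases "\<alpha> = a")
        case True
        then show ?thesis
          by (auto simp: Cauchy_Riemann_product_def dest!: Riemann_value_self intro: exI[of _ 1])
      next
        case False
        \<comment> \<open>Successors and limits in \<Lambda> are handled alike, by approaching
          \<alpha> from the left.\<close>
        show ?thesis
        proof (rule Cauchy_Riemann_product_limit)
          show "norm (A t) \<le> M" if "t \<in> {a..\<alpha>}" for t
            using that M \<alpha> by simp
          show "a < \<alpha>" using False \<alpha> by simp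
        next
          fix t assume t: "a \<le> t" "t < \<alpha>"
          \<comment> \<open>The step containing \<open>t\<close> starts at some
            \<open>\<beta> \<le> t < \<alpha>\<close>: the induction hypothesis reaches \<beta>, and
            \<open>A\<close> is constant from \<beta> to \<open>t\<close>.\<close>
          then obtain \<beta> where \<beta>: "\<beta> \<in> \<Lambda>" "\<beta> < b" "\<beta> \<le> t" "t < succ_in \<Lambda> \<beta>"
            using subsetD[OF A_domain, of t] \<alpha> by auto
          show "Cauchy_Riemann_product A a t"
          proof (rule Cauchy_Riemann_product_trans)
            show "norm (A s) \<le> M" if "s \<in> {a..t}" for s
              using that t M \<alpha> by simp
            show "a \<le> \<beta>" "\<beta> \<le> t" using \<beta> assms(2) by auto
            show "Cauchy_Riemann_product A a \<beta>"
              using 1 \<beta> t by auto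
            show "Cauchy_Riemann_product A \<beta> t"
              using \<beta> A_step by (intro Cauchy_Riemann_product_const[of _ _ _ "z \<beta>"]) auto
          qed
        qed
      qed
    qed
    then have "Cauchy_Riemann_product A a b"
      using \<open>b \<in> \<Lambda>\<close> .
    with M \<open>a < b\<close> show "Riemann_product_integrable A a b"
      by (intro Riemann_product_integrable_if_Cauchy) auto
  qed
qed

end
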